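(* Let $\ell \geq 0$ and let $G$ be the directed graph with vertex set $\mathbb{Z}$ having, for each $i\in\mathbb{Z}$, one directed edge $(i,i-1)$ and one directed edge $(i,i+1)$, and additionally $\ell$ directed loops at the vertex $0$. Let $n \geq 1$ with $n \equiv \ell \pmod 2$. Then $G$ sorts $\Delta^n$: there is a unique $G$-stable labeled configuration $\mathcal{D}$ with $\Delta^n \xrightarrow{G} \mathcal{D}$, and it satisfies $\mathcal{D}(i) \leq \mathcal{D}(j)$ for all $1 \leq i \leq j \leq n$.
   Context: A labeled configuration on $G$ is a function $\mathcal{C}\colon X\to\mathbb{Z}$ for a finite set $X\subseteq\mathbb{Z}_{>0}$ of labels, chip $(i)$ being at vertex $\mathcal{C}(i)$. $\Delta^n$ is the configuration with chips $(1),\ldots,(n)$ all at vertex $0$. Let $\mathrm{outdeg}_G(v)$ be the out-degree of $v$ (loops counted), so $\mathrm{outdeg}_G(0) = 2+\ell$ and $\mathrm{outdeg}_G(v)=2$ for $v\neq 0$. A labeled firing at $v$: choose $\mathrm{outdeg}_G(v)$ chips at $v$; the one with the smallest label moves to $v-1$, the one with the largest label moves to $v+1$, and (at $v=0$) the remaining $\ell$ chips stay at $v$. $\mathcal{C}\xrightarrow{G}\mathcal{D}$ means $\mathcal{D}$ is obtained from $\mathcal{C}$ by zero or more such firings. $\mathcal{D}$ is $G$-stable if every vertex $v$ holds fewer than $\mathrm{outdeg}_G(v)$ chips. *)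

theory Defs
  imports Main "HOL-Number_Theory.Cong" "Graph_Theory.Digraph"
begin

datatype arc = To_Left int | To_Right int | Loop nat

text \<open>\<open>Loop k\<close> with \<open>k < l\<close> are the \<open>l\<close> parallel loops at the vertex \<open>0\<close>.\<close>

definition line_graph :: "nat \<Rightarrow> (int, arc) pre_digraph" where
  "line_graph l = \<lparr>
     verts = UNIV,
     arcs = range To_Left \<union> range To_Right \<union> Loop ` {..<l},
     tail = (\<lambda>a. case a of To_Left i \<Rightarrow> i | To_Right i \<Rightarrow> i | Loop k \<Rightarrow> 0),
     head = (\<lambda>a. case a of To_Left i \<Rightarrow> i - 1 | To_Right i \<Rightarrow> i + 1 | Loop k \<Rightarrow> 0)\<rparr>"

lemma out_degree_line_graph:
  "out_degree (line_graph l) v = (if v = 0 then 2 + l else 2)"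
proof -
  have "out_arcs (line_graph l) v =
      {To_Left v, To_Right v} \<union> Loop ` (if v = 0 then {..<l} else {})"
    by (auto simp: out_arcs_def line_graph_def)
  moreover have "card (Loop ` {..<l}) = l"
    by (simp add: card_image inj_on_def)
  moreover have "card ({To_Left v, To_Right v} \<union> Loop ` {..<l}) = 2 + card (Loop ` {..<l})"
    by (subst card_Un_disjoint) auto
  ultimately show ?thesis
    by (auto simp: out_degree_def)
qed

text \<open>A labeled configuration on a finite label set \<open>X\<close> of positive integers is a partial
  map with domain \<open>X\<close>; \<open>C i = Some v\<close> says that chip \<open>i\<close> is at the vertex \<open>v\<close>.\<close>

type_synonym configuration = "nat \<rightharpoonup> int"

definition labeled_configuration :: "configuration \<Rightarrow> bool" where
  "labeled_configuration C \<longleftrightarrow> finite (dom C) \<and> dom C \<subseteq> {0<..}"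

definition chips_at :: "configuration \<Rightarrow> int \<Rightarrow> nat set" where
  "chips_at C v = {i. C i = Some v}"

definition Delta :: "nat \<Rightarrow> configuration" where
  "Delta n = (\<lambda>i. if i \<in> {1..n} then Some 0 else None)"

text \<open>\<open>S\<close> is the set of chosen chips. It has at least two elements, so its smallest and
  largest labels differ; chips of \<open>S\<close> other than these two stay at \<open>v\<close>, and occur only
  for \<open>v = 0\<close>.\<close>

definition fires :: "nat \<Rightarrow> configuration \<Rightarrow> configuration \<Rightarrow> bool" where
  "fires l C D \<longleftrightarrow>
     (\<exists>v S. S \<subseteq> chips_at C v \<and> card S = out_degree (line_graph l) v \<and>
            D = C(Min S \<mapsto> v - 1, Max S \<mapsto> v + 1))"

definition reaches :: "nat \<Rightarrow> configuration \<Rightarrow> configuration \<Rightarrow> bool" where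
  "reaches l = (fires l)\<^sup>*\<^sup>*"

definition G_stable :: "nat \<Rightarrow> configuration \<Rightarrow> bool" where
  "G_stable l C \<longleftrightarrow> (\<forall>v. card (chips_at C v) < out_degree (line_graph l) v)"

lemma fires_dom:
  assumes "fires l C D"
  shows "dom D = dom C"
proof -
  from assms obtain v S where S: "S \<subseteq> chips_at C v"
      "card S = out_degree (line_graph l) v" and D: "D = C(Min S \<mapsto> v - 1, Max S \<mapsto> v + 1)"
    by (auto simp: fires_def)
  have "card S \<noteq> 0"
    by (simp add: S(2) out_degree_line_graph)
  then have "finite S" "S \<noteq> {}"
    by (auto intro: card_ge_0_finite)
  then have "Min S \<in> S" "Max S \<in> S"
    by auto
  with S(1) D show ?thesis
    by (auto simp: chips_at_def)
qed

lemma reaches_Delta_dom: "reaches l (Delta n) D \<Longrightarrow> dom D = {1..n}"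
proof -
  assume "reaches l (Delta n) D"
  then have "dom D = dom (Delta n)"
    unfolding reaches_def by (induction rule: rtranclp_induct) (simp_all add: fires_dom)
  then show ?thesis
    by (auto simp: Delta_def split: if_splits)
qed

text \<open>Hence \<open>the (D i)\<close> is a genuine position whenever \<open>D\<close> is reached from \<open>Delta n\<close>
  and \<open>1 \<le> i \<le> n\<close>.\<close>

end

theory Submission
  imports Defs
begin

text \<open>
  If \<open>n < l\<close>, nothing can fire. Otherwise \<open>n = 2 * m + l\<close>, and the unlabeled process stabilizes to
  \<open>l\<close> chips at \<open>0\<close> and one at each \<open>v\<close> with \<open>1 \<le> \<bar>v\<bar> \<le> m\<close>, after \<open>1 + 2 + \<dots> + (m - \<bar>v\<bar>)\<close> firings
  at \<open>v\<close>. Let \<open>r v\<close> be the number of firings still to come at \<open>v\<close>. An interval of vertices that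
  have all fired holds at least as many chips as it has edges (loops included), which makes \<open>r\<close>
  nearly concave there: going right, its slope never increases by more than \<open>1\<close>, and not at all
  across the origin.

  Now colour the chips \<open>1, \<dots>, k\<close> with \<open>k \<le> m\<close>, and let \<open>N q\<close> be the number of coloured chips to the
  left of \<open>q\<close>. Near-concavity shows that firings preserve the inequality
  \<open>m + min q 0 \<le> r q + N q\<close> at all \<open>q\<close> holding a coloured chip. In a stable configuration \<open>r = 0\<close>,
  so chip \<open>k\<close> has reached \<open>k - 1 - m\<close> or a vertex further left. The mirror image of this bound
  for the \<open>m\<close> largest labels leaves only the sorted configuration.
\<close>

section \<open>Chip counts and their change under a firing\<close>

definition occ :: "nat set \<Rightarrow> (nat \<Rightarrow> int) \<Rightarrow> int \<Rightarrow> int" where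
  "occ B p q = (\<Sum>i\<in>B. of_bool (p i = q))"

definition below :: "nat set \<Rightarrow> (nat \<Rightarrow> int) \<Rightarrow> int \<Rightarrow> int" where
  "below B p q = (\<Sum>i\<in>B. of_bool (p i < q))"

definition inside :: "nat set \<Rightarrow> (nat \<Rightarrow> int) \<Rightarrow> int \<Rightarrow> int \<Rightarrow> int" where
  "inside B p a b = (\<Sum>i\<in>B. of_bool (a \<le> p i \<and> p i \<le> b))"

lemma occ_nonneg: "0 \<le> occ B p q"
  by (simp add: occ_def sum_nonneg)

lemma below_nonneg: "0 \<le> below B p q"
  by (simp add: below_def sum_nonneg)

lemma inside_nonneg: "0 \<le> inside B p a b"
  by (simp add: inside_def sum_nonneg)

lemma occ_eq_card: "finite B \<Longrightarrow> occ B p q = int (card {i \<in> B. p i = q})"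
  by (simp add: occ_def of_bool_def sum.If_cases Int_def)

lemma occ_ge_card:
  assumes "finite B" "S \<subseteq> B" "\<And>i. i \<in> S \<Longrightarrow> p i = q"
  shows "int (card S) \<le> occ B p q"
  using assms by (auto simp: occ_eq_card intro!: card_mono)

lemma occ_add_card_le:
  assumes "finite B" "S \<subseteq> B" "\<And>i. i \<in> S \<Longrightarrow> p i = q" "A \<subseteq> B" "S \<inter> A = {}"
  shows "occ A p q + int (card S) \<le> occ B p q"
proof -
  have fin: "finite A" "finite S"
    using assms finite_subset by blast+
  have "card {i \<in> A. p i = q} + card S = card ({i \<in> A. p i = q} \<union> S)"
    using fin assms(5) by (subst card_Un_disjoint) auto
  also have "\<dots> \<le> card {i \<in> B. p i = q}"
    using assms by (intro card_mono) auto
  finally show ?thesis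
    using fin assms(1) by (simp add: occ_eq_card)
qed

lemma below_succ: "below B p (q + 1) = below B p q + occ B p q"
  unfolding below_def occ_def by (subst sum.distrib [symmetric], rule sum.cong) auto

lemma inside_single: "inside B p a a = occ B p a"
  unfolding inside_def occ_def by (rule sum.cong) auto

lemma inside_split:
  assumes "a \<le> v" "v \<le> b + 1"
  shows "inside B p a b = inside B p a (v - 1) + inside B p v b"
  unfolding inside_def using assms by (subst sum.distrib [symmetric], intro sum.cong) auto

definition displace :: "nat \<Rightarrow> nat \<Rightarrow> int \<Rightarrow> (nat \<Rightarrow> int) \<Rightarrow> nat \<Rightarrow> int" where
  "displace x y v p = p(x := v - 1, y := v + 1)"

text \<open>Only the two moved chips change their summand. With \<open>g\<close> free, the update
  formulas for \<open>occ\<close>, \<open>below\<close> and \<open>inside\<close> are all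
  instances.\<close>

lemma sum_fire:
  fixes g :: "int \<Rightarrow> int"
  assumes "finite B" "x \<noteq> y" "p x = v" "p y = v"
  shows "(\<Sum>i\<in>B. g (displace x y v p i)) =
    (\<Sum>i\<in>B. g (p i)) + (if x \<in> B then g (v - 1) - g v else 0)
      + (if y \<in> B then g (v + 1) - g v else 0)"
proof -
  have "(\<Sum>i\<in>B. g (displace x y v p i)) =
      (\<Sum>i\<in>B. g (p i) + (if i = x then g (v - 1) - g v else 0)
        + (if i = y then g (v + 1) - g v else 0))"
    using assms by (intro sum.cong) (auto simp: displace_def)
  then show ?thesis
    using assms(1) by (simp add: sum.distrib)
qed

lemma occ_fire:
  assumes "finite B" "x \<noteq> y" "p x = v" "p y = v"
  shows "occ B (displace x y v p) q = occ B p q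
    + (if x \<in> B then of_bool (q = v - 1) - of_bool (q = v) else 0)
    + (if y \<in> B then of_bool (q = v + 1) - of_bool (q = v) else 0)"
  unfolding occ_def using sum_fire[where g = "\<lambda>z. of_bool (z = q)", OF assms] by (simp add: eq_commute)

lemma below_fire:
  assumes "finite B" "x \<noteq> y" "p x = v" "p y = v"
  shows "below B (displace x y v p) q = below B p q
    + (if x \<in> B then of_bool (q = v) else 0) - (if y \<in> B then of_bool (q = v + 1) else 0)"
  unfolding below_def using sum_fire[where g = "\<lambda>z. of_bool (z < q)", OF assms] by auto

lemma inside_fire:
  assumes "finite B" "x \<noteq> y" "p x = v" "p y = v"
  shows "inside B (displace x y v p) a b = inside B p a b
    + (if x \<in> B then of_bool (a \<le> v - 1 \<and> v - 1 \<le> b) - of_bool (a \<le> v \<and> v \<le> b) else 0)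
    + (if y \<in> B then of_bool (a \<le> v + 1 \<and> v + 1 \<le> b) - of_bool (a \<le> v \<and> v \<le> b) else 0)"
  unfolding inside_def
  using sum_fire[where g = "\<lambda>z. of_bool (a \<le> z \<and> z \<le> b)", OF assms] by simp

section \<open>The odometer of the unlabeled process\<close>

definition odometer :: "nat \<Rightarrow> int \<Rightarrow> int" where
  "odometer m v = int (\<Sum>{..nat (int m - \<bar>v\<bar>)})"

lemma odometer_ge: "int m - \<bar>v\<bar> \<le> odometer m v"
proof -
  have "k \<le> \<Sum>{..k}" for k :: nat
    by (rule member_le_sum) auto
  from this[of "nat (int m - \<bar>v\<bar>)"] show ?thesis
    unfolding odometer_def by linarith
qed

lemma odometer_nonneg: "0 \<le> odometer m v"
  unfolding odometer_def by (rule of_nat_0_le_iff)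

lemma odometer_outside: "int m \<le> \<bar>v\<bar> \<Longrightarrow> odometer m v = 0"
  by (simp add: odometer_def)

definition target :: "nat \<Rightarrow> nat \<Rightarrow> int \<Rightarrow> int" where
  "target m l v = (if v = 0 then int l else if \<bar>v\<bar> \<le> int m then 1 else 0)"

text \<open>Balance of chips at \<open>v\<close>: each firing at \<open>v\<close> removes two chips
  and each firing at a neighbour adds one, so firing every vertex as often as
  \<open>odometer\<close> says turns \<open>2 * m + l\<close> chips at the origin into
  \<open>target m l\<close>.\<close>

lemma odometer_laplacian:
  "target m l v + 2 * odometer m v - odometer m (v - 1) - odometer m (v + 1)
    = (if v = 0 then 2 * int m + int l else 0)"
proof -
  have T: "int (\<Sum>{..nat (k + 1)}) = int (\<Sum>{..nat k}) + k + 1" if "k \<ge> 0" for k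
    using that by (simp add: nat_add_distrib atMost_Suc)
  have out: "odometer m w = 0" if "\<bar>w\<bar> \<ge> int m" for w
    using that by (rule odometer_outside)
  \<comment> \<open>One step closer to the origin, from \<open>w'\<close> to \<open>w\<close>, the
    triangular number gains its largest summand.\<close>
  have inn: "odometer m w = odometer m w' + (int m - \<bar>w\<bar>)" if "\<bar>w'\<bar> = \<bar>w\<bar> + 1" "\<bar>w\<bar> < int m" for w w'
    using T[of "int m - \<bar>w'\<bar>"] that unfolding odometer_def by (simp add: algebra_simps)
  consider "v = 0" | "v > 0" "v < int m" | "v < 0" "- v < int m"
    | "v \<noteq> 0" "\<bar>v\<bar> = int m" | "\<bar>v\<bar> > int m"
    by linarith
  then show ?thesis
  proof cases
    case 1
    then show ?thesis
      using inn[of 1 0] inn[of "-1" 0] out[of 0] out[of 1] out[of "-1"]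
      by (cases "m = 0") (auto simp: target_def)
  next
    case 2
    then show ?thesis
      using inn[of "v + 1" v] inn[of v "v - 1"] by (auto simp: target_def)
  next
    case 3
    then show ?thesis
      using inn[of "v - 1" v] inn[of v "v + 1"] by (auto simp: target_def)
  next
    case 4
    then consider "v > 0" "v = int m" | "v < 0" "v = - int m"
      by linarith
    then show ?thesis
    proof cases
      case 1
      then show ?thesis
        using inn[of v "v - 1"] out[of v] out[of "v + 1"] by (auto simp: target_def)
    next
      case 2
      then show ?thesis
        using inn[of v "v + 1"] out[of v] out[of "v - 1"] by (auto simp: target_def)
    qed
  next
    case 5
    then show ?thesis
      using out[of v] out[of "v + 1"] out[of "v - 1"] by (auto simp: target_def)
  qed
qed

section \<open>The coloured process and the firings still to come\<close>

text \<open>\<open>\<sigma> = - 1\<close> reflects the line, so that the largest labels become the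
  ones sent left. The default 0 for absent labels turns \<open>Delta\<close> into the constant
  function that starts \<open>firing\<close>.\<close>

definition position :: "int \<Rightarrow> configuration \<Rightarrow> nat \<Rightarrow> int" where
  "position \<sigma> C i = (case C i of None \<Rightarrow> 0 | Some v \<Rightarrow> \<sigma> * v)"

text \<open>Only the colour of a chip (whether its label lies in \<open>A\<close>) is remembered, and \<open>r v\<close> is the
  number of firings still to come at \<open>v\<close>. The colour conditions hold for firings of the line when
  \<open>A\<close> is an initial segment of the labels, and for their mirror images when \<open>A\<close> is a final one.\<close>

locale coloured_firing =
  fixes m l :: nat and A :: "nat set"
  assumes A_labels: "A \<subseteq> {1..2 * m + l}"
begin

definition chips :: "nat set" where
  "chips = {1..2 * m + l}"

inductive firing :: "(nat \<Rightarrow> int) \<Rightarrow> (int \<Rightarrow> int) \<Rightarrow> bool" where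
  init: "firing (\<lambda>_. 0) (odometer m)"
| step: "firing (displace x y v p) (r(v := r v - 1))"
  if "firing p r" "S \<subseteq> chips" "\<forall>i\<in>S. p i = v"
    "card S = (if v = 0 then 2 + l else 2)" "x \<in> S" "y \<in> S" "x \<noteq> y"
    "y \<in> A \<longrightarrow> S \<subseteq> A" "x \<notin> A \<longrightarrow> S \<inter> A = {}"

lemma A_subset: "A \<subseteq> chips"
  using A_labels by (simp add: chips_def)

lemma finite_chips [simp]: "finite chips"
  by (simp add: chips_def)

lemma finite_A: "finite A"
  using A_subset finite_subset finite_chips by blast

text \<open>A firing changes both sides alike, and initially this is
  \<open>odometer_laplacian\<close>. It translates chip counts into second differences of
  \<open>r\<close>.\<close>

lemma occ_laplacian:
  "firing p r \<Longrightarrow> occ chips p v = target m l v + 2 * r v - r (v - 1) - r (v + 1)"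
proof (induction arbitrary: v rule: firing.induct)
  case init
  then show ?case
    by (simp add: odometer_laplacian) (simp add: occ_def chips_def)
next
  case (step p r S v x y w)
  then have "x \<in> chips" "y \<in> chips" "p x = v" "p y = v"
    by auto
  then have "occ chips (displace x y v p) w = occ chips p w
      + of_bool (w = v - 1) + of_bool (w = v + 1) - 2 * of_bool (w = v)"
    using occ_fire[of chips x y p v w] \<open>x \<noteq> y\<close> by simp
  then show ?case
    using step.IH[of w] by auto
qed

text \<open>A least action principle, as \<open>firing\<close> decreases \<open>r\<close> without a
  sign check: if \<open>r v = 0\<close>, the balance equation leaves at most
  \<open>target m l v\<close> chips at \<open>v\<close>, too few to fire.\<close>

lemma remaining_nonneg: "firing p r \<Longrightarrow> 0 \<le> r v"
proof (induction arbitrary: v rule: firing.induct)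
  case init
  then show ?case
    by (simp add: odometer_nonneg)
next
  case (step p r S v x y w)
  have "(if v = 0 then 2 + int l else 2) \<le> occ chips p v"
    using occ_ge_card[of chips S p v] step.hyps by (auto split: if_splits)
  then have "r v \<noteq> 0"
    using occ_laplacian[OF \<open>firing p r\<close>, of v] step.IH[of "v - 1"] step.IH[of "v + 1"]
    by (auto simp: target_def split: if_splits)
  then show ?case
    using step.IH[of w] step.IH[of v] by auto
qed

lemma remaining_le_odometer: "firing p r \<Longrightarrow> r v \<le> odometer m v"
proof (induction arbitrary: v rule: firing.induct)
  case (step p r S v x y w)
  show ?case
    using step.IH[of w] by (cases "w = v") auto
qed simp

lemma remaining_outside: "firing p r \<Longrightarrow> int m \<le> \<bar>v\<bar> \<Longrightarrow> r v = 0"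
  using remaining_nonneg[of p r v] remaining_le_odometer[of p r v] by (simp add: odometer_outside)

text \<open>Once all of \<open>{a..b}\<close> has fired, each edge inside holds the chip that last crossed it.\<close>

lemma inside_fired:
  "firing p r \<Longrightarrow> a \<le> b \<Longrightarrow> (\<And>v. a \<le> v \<Longrightarrow> v \<le> b \<Longrightarrow> r v < odometer m v) \<Longrightarrow>
    b - a + (if a \<le> 0 \<and> 0 \<le> b then int l else 0) \<le> inside chips p a b"
proof (induction arbitrary: a b rule: firing.induct)
  case init
  then show ?case
    by force
next
  case (step p r S v x y)
  let ?p = "displace x y v p"
  have xy: "x \<in> chips" "y \<in> chips" "p x = v" "p y = v"
    using step.hyps by auto
  have upd: "inside chips ?p a b = inside chips p a b + of_bool (a \<le> v - 1 \<and> v - 1 \<le> b)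
      + of_bool (a \<le> v + 1 \<and> v + 1 \<le> b) - 2 * of_bool (a \<le> v \<and> v \<le> b)" for a b
    using inside_fire[OF _ \<open>x \<noteq> y\<close> xy(3,4), of chips a b] xy(1,2) by simp
  have IH: "b - a + (if a \<le> 0 \<and> 0 \<le> b then int l else 0) \<le> inside chips p a b"
    if "a \<le> b" "\<And>w. a \<le> w \<Longrightarrow> w \<le> b \<Longrightarrow> w \<noteq> v \<and> (r(v := r v - 1)) w < odometer m w" for a b
    using that by (intro step.IH) (metis fun_upd_apply)+
  have fired: "r w < odometer m w" if "a \<le> w" "w \<le> b" "w \<noteq> v" for w
    using step.prems(2)[of w] that by simp
  show ?case
  proof (cases "a \<le> v \<and> v \<le> b")
    case False
    then show ?thesis
      using IH[of a b] step.prems by (auto simp: upd)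
  next
    \<comment> \<open>The interval is cut at \<open>v\<close>, because \<open>v\<close> may be
      firing for the first time. Each non-empty part beside \<open>v\<close> had fired before and
      gains the chip sent to it; if \<open>v = 0\<close>, the \<open>l\<close> chips that stay
      account for the loops.\<close>
    case True
    have "(if v = 0 then 2 + int l else 2) \<le> occ chips p v"
      using occ_ge_card[of chips S p v] step.hyps by (auto split: if_splits)
    then have mid: "(if v = 0 then int l else 0) \<le> inside chips ?p v v"
      using upd[of v v] by (auto simp: inside_single split: if_splits)
    have left: "v - a + (if a \<le> 0 \<and> 0 \<le> v - 1 then int l else 0) \<le> inside chips ?p a (v - 1)"
    proof (cases "a \<le> v - 1")
      case True
      then show ?thesis
        using IH[of a "v - 1"] fired \<open>a \<le> v \<and> v \<le> b\<close> by (auto simp: upd)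
    next
      case False
      then show ?thesis
        using inside_nonneg[of chips ?p a "v - 1"] \<open>a \<le> v \<and> v \<le> b\<close> by auto
    qed
    have right: "b - v + (if v + 1 \<le> 0 \<and> 0 \<le> b then int l else 0) \<le> inside chips ?p (v + 1) b"
    proof (cases "v + 1 \<le> b")
      case True
      then show ?thesis
        using IH[of "v + 1" b] fired \<open>a \<le> v \<and> v \<le> b\<close> by (auto simp: upd)
    next
      case False
      then show ?thesis
        using inside_nonneg[of chips ?p "v + 1" b] \<open>a \<le> v \<and> v \<le> b\<close> by auto
    qed
    have "inside chips ?p a b = inside chips ?p a (v - 1) + inside chips ?p v v
        + inside chips ?p (v + 1) b"
      using inside_split[of a v b chips ?p] inside_split[of v "v + 1" b chips ?p] True by simp
    then show ?thesis
      using left mid right True by (auto split: if_splits)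
  qed
qed

section \<open>Slopes of the remaining firings\<close>

text \<open>Telescoping sum of \<open>occ_laplacian\<close>: only the slopes of \<open>r\<close> at
  the two ends survive, and \<open>target\<close> contributes one chip per vertex, but
  \<open>l\<close> at the origin.\<close>

lemma inside_laplacian:
  assumes f: "firing p r" and "- int m \<le> a" "a \<le> b" "b \<le> int m"
  shows "inside chips p a b = b - a + 1 + (if a \<le> 0 \<and> 0 \<le> b then int l - 1 else 0)
    + r a - r (a - 1) + r b - r (b + 1)"
proof -
  have "b \<le> int m \<longrightarrow> ?thesis"
    using \<open>a \<le> b\<close>
  proof (induction b rule: int_ge_induct)
    case base
    show ?case
      using occ_laplacian[OF f, of a] assms(2) by (auto simp: inside_single target_def)
  next
    case (step b)
    then show ?case
      using occ_laplacian[OF f, of "b + 1"] assms(2)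
        inside_split[of a "b + 1" "b + 1" chips p]
      by (auto simp: inside_single target_def)
  qed
  then show ?thesis
    using assms by blast
qed

text \<open>Compares the exact count of \<open>inside_laplacian\<close> with the lower bound of
  \<open>inside_fired\<close>. Away from the origin there is one vertex more than edges, which is
  the slack of 1; with the origin inside, \<open>target\<close> matches edges and loops
  exactly.\<close>

lemma slope_bound:
  assumes f: "firing p r" and "a \<le> b" and fired: "\<And>v. a \<le> v \<Longrightarrow> v \<le> b \<Longrightarrow> r v < odometer m v"
  shows "r (b + 1) - r b \<le> r a - r (a - 1) + (if a \<le> 0 \<and> 0 \<le> b then 0 else 1)"
proof -
  \<comment> \<open>Outside this range \<open>odometer\<close> is zero, so no vertex there can have
    fired.\<close>
  have "\<bar>v\<bar> < int m" if "a \<le> v" "v \<le> b" for v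
    using fired[OF that] remaining_nonneg[OF f, of v] odometer_outside[of m v] by force
  from this[of a] this[of b] have "- int m \<le> a" "b \<le> int m"
    using \<open>a \<le> b\<close> by auto
  then show ?thesis
    using inside_laplacian[OF f, of a b] inside_fired[OF f \<open>a \<le> b\<close> fired] \<open>a \<le> b\<close>
    by (auto split: if_splits)
qed

section \<open>Lower bounds on \<open>r\<close> from the nearest unfired vertex\<close>

lemma unfired_ge: "firing p r \<Longrightarrow> \<not> r v < odometer m v \<Longrightarrow> int m - \<bar>v\<bar> \<le> r v"
  using odometer_ge[of m v] by linarith

text \<open>The vertex \<open>- int m\<close> never fires, so an unfired vertex exists. Its value
  \<open>r w\<close> is the starting point from which \<open>slope_bound\<close> controls
  \<open>r\<close> up to \<open>v\<close>.\<close>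

lemma last_unfired_left:
  assumes f: "firing p r" and "- int m < v"
  obtains w where "w < v" "int m - \<bar>w\<bar> \<le> r w" "\<And>u. w < u \<Longrightarrow> u < v \<Longrightarrow> r u < odometer m u"
proof -
  let ?W = "{w. - int m \<le> w \<and> w < v \<and> \<not> r w < odometer m w}"
  have "finite ?W"
    by (rule finite_subset[of _ "{- int m..v}"]) auto
  moreover have "- int m \<in> ?W"
    using assms(2) remaining_nonneg[OF f, of "- int m"] odometer_outside[of m "- int m"] by auto
  ultimately have in_W: "Max ?W \<in> ?W"
    by (intro Max_in) blast+
  show ?thesis
  proof (rule that[of "Max ?W"])
    show "r u < odometer m u" if "Max ?W < u" "u < v" for u
      using Max_ge[OF \<open>finite ?W\<close>, of u] in_W that by force
  qed (use in_W unfired_ge[OF f, of "Max ?W"] in auto)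
qed

lemma first_unfired_right:
  assumes f: "firing p r" and "v < int m"
  obtains w where "v < w" "int m - \<bar>w\<bar> \<le> r w" "\<And>u. v < u \<Longrightarrow> u < w \<Longrightarrow> r u < odometer m u"
proof -
  let ?W = "{w. w \<le> int m \<and> v < w \<and> \<not> r w < odometer m w}"
  have "finite ?W"
    by (rule finite_subset[of _ "{v..int m}"]) auto
  moreover have "int m \<in> ?W"
    using assms(2) remaining_nonneg[OF f, of "int m"] odometer_outside[of m "int m"] by auto
  ultimately have in_W: "Min ?W \<in> ?W"
    by (intro Min_in) blast+
  show ?thesis
  proof (rule that[of "Min ?W"])
    show "r u < odometer m u" if "v < u" "u < Min ?W" for u
      using Min_le[OF \<open>finite ?W\<close>, of u] in_W that by force
  qed (use in_W unfired_ge[OF f, of "Min ?W"] in auto)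
qed

text \<open>By \<open>slope_bound\<close>, a slope of 2 into \<open>v\<close> makes every slope back
  to the unfired vertex \<open>w\<close> at least 1. So \<open>r\<close> climbs by at least 1 per
  step from \<open>r w\<close> to \<open>r (v - 1)\<close>.\<close>

lemma steep_left_of_origin:
  assumes f: "firing p r" and "- int m < v" "v \<le> 0" and d: "2 \<le> r v - r (v - 1)"
  shows "int m + v - 1 \<le> r (v - 1)"
proof -
  obtain w where w: "w < v" "int m - \<bar>w\<bar> \<le> r w" "\<And>u. w < u \<Longrightarrow> u < v \<Longrightarrow> r u < odometer m u"
    using last_unfired_left[OF f assms(2)] by blast
  have "x \<le> v - 1 \<longrightarrow> int m + x \<le> r x" if "w \<le> x" for x
    using that
  proof (induction x rule: int_ge_induct)
    case base
    show ?case
      using w assms(3) by auto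
  next
    case (step x)
    show ?case
    proof
      assume "x + 1 \<le> v - 1"
      with step slope_bound[OF f, of "x + 1" "v - 1"] w(3) d assms(3)
      show "int m + (x + 1) \<le> r (x + 1)"
        by (auto split: if_splits)
    qed
  qed
  from this[of "v - 1"] w(1) show ?thesis
    by auto
qed

text \<open>Slopes further left are at least 0, and at least 1 up to the origin, since
  \<open>slope_bound\<close> has no slack across it.\<close>

lemma rising_right_of_origin:
  assumes f: "firing p r" and "1 \<le> v" and d: "1 \<le> r v - r (v - 1)"
  shows "int m - v + 1 \<le> r (v - 1)"
proof -
  have v: "- int m < v"
    using assms(2) by auto
  obtain w where w: "w < v" "int m - \<bar>w\<bar> \<le> r w" "\<And>u. w < u \<Longrightarrow> u < v \<Longrightarrow> r u < odometer m u"
    using last_unfired_left[OF f v] by blast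
  \<comment> \<open>This bound is \<open>int m - \<bar>w\<bar>\<close> at \<open>x = w\<close>,
    grows by 1 per step up to the origin and is constant beyond it.\<close>
  have "x \<le> v - 1 \<longrightarrow> int m + min x 0 - max w 0 \<le> r x" if "w \<le> x" for x
    using that
  proof (induction x rule: int_ge_induct)
    case base
    show ?case
      using w by auto
  next
    case (step x)
    show ?case
    proof
      assume "x + 1 \<le> v - 1"
      with step slope_bound[OF f, of "x + 1" "v - 1"] w(3) d assms(2)
      show "int m + min (x + 1) 0 - max w 0 \<le> r (x + 1)"
        by (auto split: if_splits)
    qed
  qed
  from this[of "v - 1"] w(1) assms(2) show ?thesis
    by auto
qed

text \<open>Mirror image of \<open>rising_right_of_origin\<close>, with the induction running left
  from an unfired vertex.\<close>

lemma falling_left_of_origin: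
  assumes f: "firing p r" and "v < 0" and d: "r (v + 1) - r v \<le> - 1"
  shows "int m + v + 1 \<le> r (v + 1)"
proof -
  have v: "v < int m"
    using assms(2) by auto
  obtain w where w: "v < w" "int m - \<bar>w\<bar> \<le> r w" "\<And>u. v < u \<Longrightarrow> u < w \<Longrightarrow> r u < odometer m u"
    using first_unfired_right[OF f v] by blast
  have "v + 1 \<le> x \<longrightarrow> int m - max x 0 + min w 0 \<le> r x" if "x \<le> w" for x
    using that
  proof (induction x rule: int_le_induct)
    case base
    show ?case
      using w by auto
  next
    case (step x)
    show ?case
    proof
      assume "v + 1 \<le> x - 1"
      with step slope_bound[OF f, of "v + 1" "x - 1"] w(3) d assms(2)
      show "int m - max (x - 1) 0 + min w 0 \<le> r (x - 1)"
        by (auto split: if_splits)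
    qed
  qed
  from this[of "v + 1"] w(1) assms(2) show ?thesis
    by auto
qed

text \<open>Mirror image of \<open>steep_left_of_origin\<close>.\<close>

lemma steep_right_of_origin:
  assumes f: "firing p r" and "0 \<le> v" "v < int m" and d: "r (v + 1) - r v \<le> - 2"
  shows "int m - v - 1 \<le> r (v + 1)"
proof -
  obtain w where w: "v < w" "int m - \<bar>w\<bar> \<le> r w" "\<And>u. v < u \<Longrightarrow> u < w \<Longrightarrow> r u < odometer m u"
    using first_unfired_right[OF f assms(3)] by blast
  have "v + 1 \<le> x \<longrightarrow> int m - x \<le> r x" if "x \<le> w" for x
    using that
  proof (induction x rule: int_le_induct)
    case base
    show ?case
      using w assms(2) by auto
  next
    case (step x)
    show ?case
    proof
      assume "v + 1 \<le> x - 1"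
      with step slope_bound[OF f, of "v + 1" "x - 1"] w(3) d assms(2)
      show "int m - (x - 1) \<le> r (x - 1)"
        by (auto split: if_splits)
    qed
  qed
  from this[of "v + 1"] w(1) show ?thesis
    by auto
qed

section \<open>Bounds for coloured chips\<close>

text \<open>Colour prefers the chip going left. In the last bound \<open>S\<close> is wholly
  uncoloured and therefore counted on top of the coloured chips at \<open>v\<close>.\<close>

lemma fire_colours:
  assumes "S \<subseteq> chips" "\<forall>i\<in>S. p i = v" "card S = (if v = 0 then 2 + l else 2)"
    "x \<in> S" "y \<in> S" "y \<in> A \<longrightarrow> S \<subseteq> A" "x \<notin> A \<longrightarrow> S \<inter> A = {}"
  shows "x \<in> A \<Longrightarrow> 1 \<le> occ A p v"
    and "y \<in> A \<Longrightarrow> x \<in> A \<and> 2 \<le> occ A p v"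
    and "x \<notin> A \<Longrightarrow> occ A p v + (if v = 0 then 2 + int l else 2) \<le> occ chips p v"
proof -
  show "1 \<le> occ A p v" if "x \<in> A"
    using occ_ge_card[OF finite_A, of "{x}" p v] assms(2,4) that by auto
  show "x \<in> A \<and> 2 \<le> occ A p v" if "y \<in> A"
    using occ_ge_card[OF finite_A, of S p v] assms that by (auto split: if_splits)
  show "occ A p v + (if v = 0 then 2 + int l else 2) \<le> occ chips p v" if "x \<notin> A"
    using occ_add_card_le[of chips S p v A] assms A_subset that by (auto split: if_splits)
qed

text \<open>When a coloured chip goes right from \<open>v\<close>, another coloured one goes left,
  so afterwards at least one more coloured chip lies below \<open>v + 1\<close> than lay below
  \<open>v\<close> before.\<close>

lemma coloured_below_right:
  "firing p r \<Longrightarrow> 1 \<le> occ A p q \<Longrightarrow> 0 \<le> q \<Longrightarrow> q \<le> below A p q"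
proof (induction arbitrary: q rule: firing.induct)
  case init
  then show ?case
    by (cases "q = 0") (auto simp: occ_def below_def)
next
  case (step p r S v x y)
  have xy: "p x = v" "p y = v"
    using step.hyps by auto
  have occ: "occ A (displace x y v p) q = occ A p q
    + (if x \<in> A then of_bool (q = v - 1) - of_bool (q = v) else 0)
    + (if y \<in> A then of_bool (q = v + 1) - of_bool (q = v) else 0)"
    using finite_A step.hyps xy by (intro occ_fire) auto
  have bel: "below A (displace x y v p) q = below A p q
    + (if x \<in> A then of_bool (q = v) else 0) - (if y \<in> A then of_bool (q = v + 1) else 0)"
    using finite_A step.hyps xy by (intro below_fire) auto
  note col = fire_colours[OF step.hyps(2-6,8,9)]
  have "below A p v = below A p (v - 1) + occ A p (v - 1)"
    "below A p (v + 1) = below A p v + occ A p v"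
    using below_succ[of A p "v - 1"] below_succ[of A p v] by auto
  note N = this
  \<comment> \<open>In the first case the chip comes from the right to a vertex without coloured
    chips, so \<open>below\<close> agreed at \<open>v - 1\<close> and \<open>v\<close> before the
    firing. In the second it comes from the left.\<close>
  consider "q = v - 1" "occ A p q = 0" | "q = v + 1" "y \<in> A" | "1 \<le> occ A p q" "q \<noteq> v + 1 \<or> y \<notin> A"
    using step.prems(1) occ occ_nonneg[of A p q] by (fastforce simp: of_bool_def split: if_splits)
  then show ?case
  proof cases
    case 1
    then have "x \<in> A"
      using step.prems(1) occ by (auto split: if_splits)
    then show ?thesis
      using step.IH[of v] step.prems(2) col(1) N(1) bel 1 by auto
  next
    case 2
    then show ?thesis
      using step.IH[of v] step.prems(2) col(2) N(2) bel below_nonneg[of A p v]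
      by (cases "0 \<le> v") auto
  next
    case 3
    then show ?thesis
      using step.IH[of q] step.prems(2) bel by (auto split: if_splits)
  qed
qed

text \<open>A coloured chip with \<open>N\<close> coloured chips strictly to its left still sees enough firings to
  be carried to the left end, up to the room taken by those \<open>N\<close> chips.\<close>

lemma coloured_remaining:
  "firing p r \<Longrightarrow> 1 \<le> occ A p q \<Longrightarrow> int m + min q 0 \<le> r q + below A p q"
proof (induction arbitrary: q rule: firing.induct)
  case init
  then have "q = 0"
    by (cases "q = 0") (auto simp: occ_def)
  then show ?case
    using odometer_ge[of m 0] below_nonneg[of A "\<lambda>_. 0" 0] by auto
next
  case (step p r S v x y)
  note f = \<open>firing p r\<close>
  have xy: "p x = v" "p y = v"
    using step.hyps by auto
  have occ: "occ A (displace x y v p) q = occ A p q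
    + (if x \<in> A then of_bool (q = v - 1) - of_bool (q = v) else 0)
    + (if y \<in> A then of_bool (q = v + 1) - of_bool (q = v) else 0)"
    using finite_A step.hyps xy by (intro occ_fire) auto
  have bel: "below A (displace x y v p) q = below A p q
    + (if x \<in> A then of_bool (q = v) else 0) - (if y \<in> A then of_bool (q = v + 1) else 0)"
    using finite_A step.hyps xy by (intro below_fire) auto
  note col = fire_colours[OF step.hyps(2-6,8,9)]
  have "0 \<le> (r(v := r v - 1)) v"
    by (rule remaining_nonneg[OF firing.step[OF step.hyps]])
  then have v: "\<bar>v\<bar> < int m"
    using remaining_outside[OF f, of v] by force
  have N: "below A p v = below A p (v - 1) + occ A p (v - 1)"
    "below A p (v + 1) = below A p v + occ A p v"
    using below_succ[of A p "v - 1"] below_succ[of A p v] by auto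
  have N0: "0 \<le> below A p v"
    by (rule below_nonneg)
  have right: "v \<le> below A p v" if "1 \<le> occ A p v" "0 \<le> v"
    using coloured_below_right[OF f that] .
  consider "q = v - 1" | "q = v" | "q = v + 1" | "q \<noteq> v - 1" "q \<noteq> v" "q \<noteq> v + 1"
    by blast
  then show ?case
  proof cases
    case 1
    show ?thesis
    proof (cases "1 \<le> occ A p q")
      case True
      then show ?thesis
        using step.IH[of q] 1 bel by auto
    next
      case False
      then have "x \<in> A" and 0: "occ A p (v - 1) = 0"
        using step.prems occ 1 occ_nonneg[of A p q] by (auto split: if_splits)
      then have s: "1 \<le> occ A p v"
        using col by auto
      note IH = step.IH[OF this]
      \<comment> \<open>No coloured chip was at \<open>v - 1\<close>, so \<open>below\<close> agrees
        there and at \<open>v\<close>. Either \<open>r\<close> loses little enough from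
        \<open>v\<close> to \<open>v - 1\<close> for the bound at \<open>v\<close> to carry over, or
        the slope is so large that it yields the bound directly.\<close>
      have "int m + min (v - 1) 0 \<le> r (v - 1) + below A p v"
      proof (cases "v \<le> 0")
        case True
        then show ?thesis
          using steep_left_of_origin[OF f, of v] IH v N0 by (cases "2 \<le> r v - r (v - 1)") auto
      next
        case False
        then show ?thesis
          using rising_right_of_origin[OF f, of v] IH right[OF s]
          by (cases "1 \<le> r v - r (v - 1)") auto
      qed
      then show ?thesis
        using 1 bel N 0 by auto
    qed
  next
    case 2
    show ?thesis
    proof (cases "x \<in> A")
      \<comment> \<open>The firing used up at \<open>v\<close> is offset by \<open>x\<close>, which
        is now counted to the left of \<open>v\<close>.\<close>
      case True
      then show ?thesis
        using step.IH[of v] col 2 bel by auto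
    next
      case False
      then have "y \<notin> A"
        using col by auto
      then have s: "1 \<le> occ A p v"
        using step.prems occ 2 False by auto
      \<comment> \<open>The chips of \<open>S\<close> are all uncoloured and a coloured chip is
        present as well, so \<open>v\<close> holds one chip more than its out-degree. Subtracting
        \<open>target\<close> leaves a drop of the slope of at least 2, or 3 at the origin. Hence
        one of the two slopes is large enough for a slope lemma, which gives the strict inequality
        that allows \<open>r v\<close> to decrease.\<close>
      have drop: "(if v = 0 then 3 else 2) \<le> (r v - r (v - 1)) - (r (v + 1) - r v)"
        using col(3)[OF False] s occ_laplacian[OF f, of v] v
        by (auto simp: target_def split: if_splits)
      have "int m + min v 0 < r v + below A p v"
      proof (cases "v \<le> 0")
        case True
        show ?thesis
        proof (cases "2 \<le> r v - r (v - 1)")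
          case steep: True
          then show ?thesis
            using steep_left_of_origin[OF f _ True steep] True v N0 by simp
        next
          case False
          then show ?thesis
            using falling_left_of_origin[OF f, of v] steep_right_of_origin[OF f, of v] drop True v N0
            by (cases "v = 0") auto
        qed
      next
        case False
        then show ?thesis
          using rising_right_of_origin[OF f, of v] steep_right_of_origin[OF f, of v] drop v right[OF s]
          by (cases "1 \<le> r v - r (v - 1)") auto
      qed
      then show ?thesis
        using 2 bel False \<open>y \<notin> A\<close> by auto
    qed
  next
    case 3
    show ?thesis
    proof (cases "y \<in> A")
      case False
      then show ?thesis
        using step.IH[of q] 3 bel occ step.prems by (auto split: if_splits)
    next
      case True
      then have s: "2 \<le> occ A p v"
        using col by auto
      then have IH: "int m + min v 0 \<le> r v + below A p v"
        using step.IH[of v] by auto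
      \<comment> \<open>The extra 1 is the coloured chip \<open>x\<close>: of the at least two
        coloured chips at \<open>v\<close>, only \<open>y\<close> leaves the count below
        \<open>v + 1\<close>.\<close>
      have "int m + min (v + 1) 0 \<le> r (v + 1) + below A p v + 1"
      proof (cases "v < 0")
        case True
        then show ?thesis
          using falling_left_of_origin[OF f, of v] IH N0
          by (cases "r (v + 1) - r v \<le> - 1") auto
      next
        case False
        then show ?thesis
          using steep_right_of_origin[OF f, of v] IH right s v
          by (cases "r (v + 1) - r v \<le> - 2") auto
      qed
      then show ?thesis
        using 3 bel True N s by auto
    qed
  next
    case 4
    then show ?thesis
      using step.IH[of q] step.prems occ bel by (simp split: if_splits)
  qed
qed

section \<open>Stable configurations of the coloured process\<close>

text \<open>Take the maximal interval around \<open>v\<close> on which \<open>r\<close> is positive.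
  Stability allows it one chip per vertex and \<open>l\<close> more at the origin;
  \<open>inside_laplacian\<close> then forces the values of \<open>r\<close> at its two ends to sum
  to less than 2, although both are positive.\<close>

lemma stable_remaining_zero:
  assumes f: "firing p r" and stable: "\<And>v. occ chips p v < (if v = 0 then 2 + int l else 2)"
  shows "r v = 0"
proof (rule ccontr)
  assume "r v \<noteq> 0"
  then have "0 < r v"
    using remaining_nonneg[OF f, of v] by linarith
  have out: "r w = 0" if "int m \<le> \<bar>w\<bar>" for w
    using remaining_outside[OF f that] .
  then have v: "\<bar>v\<bar> < int m"
    using \<open>r v \<noteq> 0\<close> by force
  let ?a = "Max {w. - int m \<le> w \<and> w \<le> v \<and> r w = 0}" and ?b = "Min {w. w \<le> int m \<and> v \<le> w \<and> r w = 0}"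
  have fin: "finite {w. - int m \<le> w \<and> w \<le> v \<and> r w = 0}" "finite {w. w \<le> int m \<and> v \<le> w \<and> r w = 0}"
    by (rule finite_subset[of _ "{- int m..int m}"]; use v in auto)+
  have "- int m \<in> {w. - int m \<le> w \<and> w \<le> v \<and> r w = 0}" "int m \<in> {w. w \<le> int m \<and> v \<le> w \<and> r w = 0}"
    using v out by auto
  then have a: "?a \<in> {w. - int m \<le> w \<and> w \<le> v \<and> r w = 0}"
    and b: "?b \<in> {w. w \<le> int m \<and> v \<le> w \<and> r w = 0}"
    using Max_in[OF fin(1)] Min_in[OF fin(2)] by blast+
  obtain a b where ab: "- int m \<le> a" "a < v" "r a = 0" "b \<le> int m" "v < b" "r b = 0"
    and pos: "\<And>w. a < w \<Longrightarrow> w < b \<Longrightarrow> r w \<noteq> 0"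
  proof
    show "- int m \<le> ?a" "r ?a = 0" "?b \<le> int m" "r ?b = 0"
      using a b by auto
    show "?a < v" "v < ?b"
      using a b \<open>r v \<noteq> 0\<close> by (auto simp: order_less_le)
    show "r w \<noteq> 0" if "?a < w" "w < ?b" for w
      using Max_ge[OF fin(1), of w] Min_le[OF fin(2), of w] that a b by fastforce
  qed
  have "inside chips p (a + 1) x \<le> x - a + (if a + 1 \<le> 0 \<and> 0 \<le> x then int l else 0)"
    if "a + 1 \<le> x" for x
    using that
  proof (induction x rule: int_ge_induct)
    case base
    show ?case
      using stable[of "a + 1"] by (auto simp: inside_single split: if_splits)
  next
    case (step x)
    then show ?case
      using stable[of "x + 1"] inside_split[of "a + 1" "x + 1" "x + 1" chips p]
      by (auto simp: inside_single split: if_splits)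
  qed
  from this[of "b - 1"] have "r (a + 1) + r (b - 1) < 2"
    using inside_laplacian[OF f, of "a + 1" "b - 1"] ab by (auto split: if_splits)
  moreover have "r (a + 1) \<noteq> 0" "r (b - 1) \<noteq> 0"
    using pos[of "a + 1"] pos[of "b - 1"] ab by auto
  ultimately show False
    using remaining_nonneg[OF f, of "a + 1"] remaining_nonneg[OF f, of "b - 1"] by linarith
qed

lemma stable_occ:
  assumes "firing p r" "\<And>v. occ chips p v < (if v = 0 then 2 + int l else 2)"
  shows "occ chips p v = target m l v"
  using occ_laplacian[OF assms(1), of v] stable_remaining_zero[OF assms] by simp

text \<open>With \<open>r = 0\<close>, all of \<open>coloured_remaining\<close> rests on the
  coloured chips left of \<open>i\<close>, at most \<open>card A - 1\<close> since \<open>i\<close>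
  is not one of them. As \<open>card A \<le> m\<close>, the minimum with 0 must be
  \<open>p i\<close> itself.\<close>

lemma stable_coloured_le:
  assumes f: "firing p r" and stable: "\<And>v. occ chips p v < (if v = 0 then 2 + int l else 2)"
    and "card A \<le> m" "i \<in> A"
  shows "p i \<le> int (card A) - 1 - int m"
proof -
  have "1 \<le> occ A p (p i)"
    using occ_ge_card[OF finite_A, of "{i}" p "p i"] \<open>i \<in> A\<close> by auto
  then have "int m + min (p i) 0 \<le> below A p (p i)"
    using coloured_remaining[OF f, of "p i"] stable_remaining_zero[OF f stable] by simp
  also have "below A p (p i) = (\<Sum>j\<in>A - {i}. of_bool (p j < p i))"
    unfolding below_def using sum.remove[OF finite_A \<open>i \<in> A\<close>, of "\<lambda>j. of_bool (p j < p i)"] by simp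
  also have "\<dots> \<le> (\<Sum>j\<in>A - {i}. 1)"
    by (rule sum_mono) auto
  also have "\<dots> = int (card A) - 1"
    using card_Suc_Diff1[OF finite_A \<open>i \<in> A\<close>] by simp
  finally show ?thesis
    using assms(3) by (auto split: if_splits simp: min_def)
qed

section \<open>From labeled firings to coloured ones\<close>

text \<open>\<open>A\<close> is closed downwards in the order of the labels multiplied by
  \<open>\<sigma>\<close>. In this order \<open>x\<close> is the least chip of \<open>S\<close> and
  \<open>y\<close> the greatest, which gives the colour conditions.\<close>

lemma firing_fires:
  assumes f: "firing (position \<sigma> C) r" and "fires l C D" and dom: "dom C = chips"
    and \<sigma>: "\<sigma> = 1 \<or> \<sigma> = - 1"
    and A: "\<And>i j. i \<in> chips \<Longrightarrow> j \<in> A \<Longrightarrow> \<sigma> * int i \<le> \<sigma> * int j \<Longrightarrow> i \<in> A"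
  shows "\<exists>v. firing (position \<sigma> D) (r(v := r v - 1))"
proof -
  obtain w S where S: "S \<subseteq> chips_at C w" "card S = (if w = 0 then 2 + l else 2)"
    and D: "D = C(Min S \<mapsto> w - 1, Max S \<mapsto> w + 1)"
    using \<open>fires l C D\<close> by (auto simp: fires_def out_degree_line_graph)
  have "2 \<le> card S"
    using S(2) by simp
  then have fin: "finite S" "S \<noteq> {}"
    by (auto intro: card_ge_0_finite)
  have ne: "Min S \<noteq> Max S"
  proof
    assume "Min S = Max S"
    then have "S \<subseteq> {Min S}"
      using Min_le[OF fin(1)] Max_ge[OF fin(1)] by (metis antisym singletonI subsetI)
    then have "card S \<le> card {Min S}"
      by (intro card_mono) auto
    with \<open>2 \<le> card S\<close> show False
      by simp
  qed
  \<comment> \<open>Reflection exchanges left and right, hence the roles of the smallest and the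
    largest label.\<close>
  define x y where "x = (if \<sigma> = 1 then Min S else Max S)" and "y = (if \<sigma> = 1 then Max S else Min S)"
  have "S \<subseteq> chips"
    using S(1) dom by (auto simp: chips_at_def)
  have xy: "x \<in> S" "y \<in> S" "x \<noteq> y"
    using Min_in[OF fin] Max_in[OF fin] ne by (auto simp: x_def y_def)
  have between: "\<sigma> * int x \<le> \<sigma> * int i" "\<sigma> * int i \<le> \<sigma> * int y" if "i \<in> S" for i
    using \<sigma> Min_le[OF fin(1) that] Max_ge[OF fin(1) that] by (auto simp: x_def y_def)
  have "position \<sigma> D = displace x y (\<sigma> * w) (position \<sigma> C)"
    using \<sigma> ne by (auto simp: D position_def displace_def x_def y_def fun_eq_iff)
  moreover have "firing (displace x y (\<sigma> * w) (position \<sigma> C)) (r(\<sigma> * w := r (\<sigma> * w) - 1))"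
  proof (rule firing.step[OF f \<open>S \<subseteq> chips\<close> _ _ xy])
    show "\<forall>i\<in>S. position \<sigma> C i = \<sigma> * w"
      using S(1) by (auto simp: chips_at_def position_def)
    show "card S = (if \<sigma> * w = 0 then 2 + l else 2)"
      using S(2) \<sigma> by auto
    show "y \<in> A \<longrightarrow> S \<subseteq> A"
      using A[OF _ _ between(2)] \<open>S \<subseteq> chips\<close> by blast
    show "x \<notin> A \<longrightarrow> S \<inter> A = {}"
      using A[OF _ _ between(1)] \<open>S \<subseteq> chips\<close> xy(1) by blast
  qed
  ultimately show ?thesis
    by auto
qed

lemma reaches_firing:
  assumes "reaches l (Delta (2 * m + l)) C" "\<sigma> = 1 \<or> \<sigma> = - 1"
    and "\<And>i j. i \<in> chips \<Longrightarrow> j \<in> A \<Longrightarrow> \<sigma> * int i \<le> \<sigma> * int j \<Longrightarrow> i \<in> A"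
  shows "\<exists>r. firing (position \<sigma> C) r"
  using assms(1) unfolding reaches_def
proof (induction rule: rtranclp_induct)
  case base
  have "position \<sigma> (Delta (2 * m + l)) = (\<lambda>_. 0)"
    by (auto simp: position_def Delta_def)
  then show ?case
    using firing.init by auto
next
  case (step C D)
  have "dom C = chips"
    using reaches_Delta_dom[of l "2 * m + l" C] step.hyps(1) by (simp add: reaches_def chips_def)
  moreover obtain r where "firing (position \<sigma> C) r"
    using step.IH by blast
  ultimately have "\<exists>v. firing (position \<sigma> D) (r(v := r v - 1))"
    using firing_fires[OF _ step.hyps(2) _ assms(2)] assms(3) by blast
  then show ?case
    by blast
qed

end

section \<open>Stable configurations are sorted\<close>

lemma card_chips_at:
  assumes "dom C = {1..n}" "\<sigma> = 1 \<or> \<sigma> = - 1"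
  shows "int (card (chips_at C v)) = occ {1..n} (position \<sigma> C) (\<sigma> * v)"
proof -
  have "chips_at C v = {i \<in> {1..n}. position \<sigma> C i = \<sigma> * v}"
    unfolding assms(1) [symmetric] using assms(2)
    by (auto simp: chips_at_def position_def)
  then show ?thesis
    by (simp add: occ_eq_card)
qed

lemma stable_occ_less:
  assumes "dom C = {1..n}" "\<sigma> = 1 \<or> \<sigma> = - 1" "G_stable l C"
  shows "occ {1..n} (position \<sigma> C) v < (if v = 0 then 2 + int l else 2)"
proof -
  have "\<sigma> * (\<sigma> * v) = v"
    using assms(2) by auto
  moreover have "card (chips_at C (\<sigma> * v)) < (if \<sigma> * v = 0 then 2 + l else 2)"
    using assms(3) unfolding G_stable_def out_degree_line_graph by blast
  ultimately show ?thesis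
    using card_chips_at[OF assms(1,2), of "\<sigma> * v"] assms(2) by (auto split: if_splits)
qed

definition sorted_configuration :: "nat \<Rightarrow> nat \<Rightarrow> configuration" where
  "sorted_configuration m l i =
     (if i \<in> {1..m} then Some (int i - 1 - int m)
      else if i \<in> {m + 1..m + l} then Some 0
      else if i \<in> {m + l + 1..2 * m + l} then Some (int i - int m - int l)
      else None)"

text \<open>By strong induction the smaller labels occupy every vertex from \<open>- int m\<close>
  up to just below the upper bound, so injectivity leaves only the bound itself.\<close>

lemma squeezed_positions:
  fixes q :: "nat \<Rightarrow> int"
  assumes "inj_on q {1..m}" and "\<And>i. i \<in> {1..m} \<Longrightarrow> - int m \<le> q i"
    and "\<And>i. i \<in> {1..m} \<Longrightarrow> q i \<le> int i - 1 - int m"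
  shows "i \<in> {1..m} \<Longrightarrow> q i = int i - 1 - int m"
proof (induction i rule: less_induct)
  case (less i)
  show ?case
  proof (rule ccontr)
    assume ne: "q i \<noteq> int i - 1 - int m"
    \<comment> \<open>The smaller label that already sits at \<open>q i\<close>.\<close>
    define j where "j = nat (q i + int m + 1)"
    have j: "j \<in> {1..m}" "j < i" "q i = int j - 1 - int m"
      using assms(2,3)[of i] less.prems ne by (auto simp: j_def)
    then have "q j = q i"
      using less.IH[of j] by simp
    then show False
      using inj_onD[OF assms(1), of j i] j less.prems by auto
  qed
qed

lemma stable_eq_sorted:
  assumes reach: "reaches l (Delta (2 * m + l)) C" and stable: "G_stable l C"
  shows "C = sorted_configuration m l"
proof -
  let ?n = "2 * m + l"
  have dom: "dom C = {1..?n}"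
    using reaches_Delta_dom[OF reach] .
  note less = stable_occ_less[OF dom _ stable]
  define p where "p = position 1 C"
  have C: "C i = Some (p i)" if "i \<in> {1..?n}" for i
    using that dom by (auto simp: p_def position_def split: option.splits)
  have occ: "occ {1..?n} p v = target m l v" for v
  proof -
    \<comment> \<open>With \<open>A\<close> empty the colour conditions hold trivially; only
      occupation numbers are wanted.\<close>
    interpret coloured_firing m l "{}"
      by standard auto
    have "\<exists>r. firing p r"
      unfolding p_def by (rule reaches_firing[OF reach]) auto
    then obtain r where f: "firing p r"
      by blast
    show ?thesis
      by (rule stable_occ[OF f, unfolded chips_def]) (unfold p_def, rule less, simp)
  qed
  have unique: "i = j" if "i \<in> {1..?n}" "j \<in> {1..?n}" "p i = p j" "p i \<noteq> 0" for i j
  proof (rule ccontr)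
    assume "i \<noteq> j"
    have "int (card {i, j}) \<le> occ {1..?n} p (p i)"
      by (rule occ_ge_card) (use that in auto)
    then show False
      using occ[of "p i"] \<open>i \<noteq> j\<close> \<open>p i \<noteq> 0\<close> by (simp add: target_def split: if_splits)
  qed
  have bound: "\<bar>p i\<bar> \<le> int m" if "i \<in> {1..?n}" for i
  proof -
    have "int (card {i}) \<le> occ {1..?n} p (p i)"
      by (rule occ_ge_card) (use that in auto)
    then show ?thesis
      using occ[of "p i"] by (simp add: target_def split: if_splits)
  qed
  have left: "p i \<le> int i - 1 - int m" if "i \<in> {1..m}" for i
  proof -
    \<comment> \<open>Exactly \<open>i\<close> chips are coloured, so the bound for chip
      \<open>i\<close> is its place in the sorted configuration.\<close>
    interpret coloured_firing m l "{1..i}"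
      by standard (use that in auto)
    have "\<exists>r. firing p r"
      unfolding p_def by (rule reaches_firing[OF reach]) (auto simp: chips_def)
    then obtain r where f: "firing p r"
      by blast
    show ?thesis
      using stable_coloured_le[OF f, of i] less[of 1] that by (simp add: p_def chips_def)
  qed
  have right: "- p (?n + 1 - i) \<le> int i - 1 - int m" if "i \<in> {1..m}" for i
  proof -
    \<comment> \<open>The \<open>i\<close> largest labels form an initial segment after reflection,
      with chip \<open>?n + 1 - i\<close> in the role of chip \<open>i\<close>.\<close>
    interpret coloured_firing m l "{?n + 1 - i..?n}"
      by standard (use that in auto)
    have "\<exists>r. firing (position (- 1) C) r"
      by (rule reaches_firing[OF reach]) (auto simp: chips_def)
    then obtain r where f: "firing (position (- 1) C) r"
      by blast
    have "position (- 1) C (?n + 1 - i) \<le> int (card {?n + 1 - i..?n}) - 1 - int m"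
      by (rule stable_coloured_le[OF f]) (use less[of "- 1"] that in \<open>auto simp: chips_def\<close>)
    moreover have "position (- 1) C (?n + 1 - i) = - p (?n + 1 - i)"
      by (auto simp: p_def position_def split: option.splits)
    ultimately show ?thesis
      using that by auto
  qed
  have left_eq: "p i = int i - 1 - int m" if "i \<in> {1..m}" for i
  proof (rule squeezed_positions[OF _ _ left that])
    show "inj_on p {1..m}"
    proof (rule inj_onI)
      fix i j
      assume ij: "i \<in> {1..m}" "j \<in> {1..m}" "p i = p j"
      show "i = j"
        by (rule unique[OF _ _ ij(3)]) (use ij(1,2) left[OF ij(1)] in auto)
    qed
    show "- int m \<le> p i" if "i \<in> {1..m}" for i
      using bound[of i] that by auto
  qed
  have right_eq': "- p (?n + 1 - i) = int i - 1 - int m" if "i \<in> {1..m}" for i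
  proof (rule squeezed_positions[of "\<lambda>i. - p (?n + 1 - i)", OF _ _ right that])
    show "inj_on (\<lambda>i. - p (?n + 1 - i)) {1..m}"
    proof (rule inj_onI)
      fix i j
      assume ij: "i \<in> {1..m}" "j \<in> {1..m}" "- p (?n + 1 - i) = - p (?n + 1 - j)"
      have "?n + 1 - i \<in> {1..?n}" "?n + 1 - j \<in> {1..?n}" "p (?n + 1 - i) \<noteq> 0"
        using ij right[OF ij(1)] by auto
      moreover have "p (?n + 1 - i) = p (?n + 1 - j)"
        using ij(3) by linarith
      ultimately have "?n + 1 - i = ?n + 1 - j"
        using unique by blast
      then show "i = j"
        using ij(1,2) by auto
    qed
    show "- int m \<le> - p (?n + 1 - i)" if "i \<in> {1..m}" for i
    proof -
      have "?n + 1 - i \<in> {1..?n}"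
        using that by auto
      from bound[OF this] show ?thesis
        by linarith
    qed
  qed
  have right_eq: "p i = int i - int m - int l" if "i \<in> {m + l + 1..?n}" for i
  proof -
    have "?n + 1 - i \<in> {1..m}" "?n + 1 - (?n + 1 - i) = i"
      using that by auto
    then have "- p i = int (?n + 1 - i) - 1 - int m"
      using right_eq' by metis
    then show ?thesis
      using that by auto
  qed
  \<comment> \<open>Each non-zero vertex within distance \<open>m\<close> is already taken by an
    outer chip and, by \<open>unique\<close>, has no room for another.\<close>
  have middle: "p i = 0" if i: "i \<in> {m + 1..m + l}" for i
  proof (rule ccontr)
    assume "p i \<noteq> 0"
    then consider "p i < 0" | "0 < p i"
      by linarith
    then show False
    proof cases
      case 1
      define j where "j = nat (p i + int m + 1)"
      have "j \<in> {1..m}" "p i = int j - 1 - int m"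
        using 1 bound[of i] i by (auto simp: j_def)
      then show False
        using unique[OF _ _ _ \<open>p i \<noteq> 0\<close>, of j] left_eq[of j] i by auto
    next
      case 2
      define j where "j = nat (p i + int m + int l)"
      have "j \<in> {m + l + 1..?n}" "p i = int j - int m - int l"
        using 2 bound[of i] i by (auto simp: j_def)
      then show False
        using unique[OF _ _ _ \<open>p i \<noteq> 0\<close>, of j] right_eq[of j] i by auto
    qed
  qed
  show ?thesis
  proof
    fix i
    show "C i = sorted_configuration m l i"
      using C[of i] left_eq[of i] middle[of i] right_eq[of i] dom
      by (cases "i \<in> {1..?n}") (auto simp: sorted_configuration_def)
  qed
qed

lemma sorted_configuration_mono:
  "1 \<le> i \<Longrightarrow> i \<le> j \<Longrightarrow> j \<le> 2 * m + l \<Longrightarrow>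
    the (sorted_configuration m l i) \<le> the (sorted_configuration m l j)"
  by (auto simp: sorted_configuration_def)

section \<open>Termination and conclusion\<close>

text \<open>Each firing lowers the total of \<open>r\<close> over \<open>{- int m..int m}\<close> by
  one while it stays non-negative, so firing as long as possible ends in a stable
  configuration.\<close>

lemma ex_stable:
  assumes "reaches l (Delta (2 * m + l)) C"
  shows "\<exists>D. reaches l (Delta (2 * m + l)) D \<and> G_stable l D"
proof -
  interpret coloured_firing m l "{}"
    by standard auto
  have total: "0 \<le> (\<Sum>v\<in>{- int m..int m}. r v)" if "firing p r" for p r
    using remaining_nonneg[OF that] by (simp add: sum_nonneg)
  have "\<exists>D. reaches l (Delta (2 * m + l)) D \<and> G_stable l D"
    if "reaches l (Delta (2 * m + l)) C" "firing (position 1 C) r" for C r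
    using that
  proof (induction "nat (\<Sum>v\<in>{- int m..int m}. r v)" arbitrary: C r rule: less_induct)
    case less
    show ?case
    proof (cases "G_stable l C")
      case True
      then show ?thesis
        using less.prems by blast
    next
      case False
      then obtain v where "out_degree (line_graph l) v \<le> card (chips_at C v)"
        by (auto simp: G_stable_def not_less)
      then obtain S where "S \<subseteq> chips_at C v" "card S = out_degree (line_graph l) v"
        by (metis obtain_subset_with_card_n)
      then obtain D where D: "fires l C D"
        by (auto simp: fires_def)
      then have reach: "reaches l (Delta (2 * m + l)) D"
        using less.prems(1) by (auto simp: reaches_def)
      have "dom C = chips"
        using reaches_Delta_dom[OF less.prems(1)] by (simp add: chips_def)
      then obtain w where f: "firing (position 1 D) (r(w := r w - 1))"
        using firing_fires[OF less.prems(2) D] by auto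
      \<comment> \<open>Since \<open>r w - 1\<close> is still non-negative, \<open>r w\<close> is
        positive, which excludes the vertices outside the range.\<close>
      have w: "w \<in> {- int m..int m}"
        using remaining_outside[OF less.prems(2), of w] remaining_nonneg[OF f, of w] by force
      have "(\<Sum>v\<in>{- int m..int m}. (r(w := r w - 1)) v)
          = r w - 1 + (\<Sum>v\<in>{- int m..int m} - {w}. r v)"
        using w by (subst sum.remove[of _ w]) (auto intro: sum.cong)
      also have "\<dots> = (\<Sum>v\<in>{- int m..int m}. r v) - 1"
        using w by (subst (2) sum.remove[of _ w]) auto
      finally have "nat (\<Sum>v\<in>{- int m..int m}. (r(w := r w - 1)) v)
          < nat (\<Sum>v\<in>{- int m..int m}. r v)"
        using total[OF f] by linarith
      then show ?thesis
        using less.hyps reach f by blast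
    qed
  qed
  moreover have "\<exists>r. firing (position 1 C) r"
    by (rule reaches_firing[OF assms]) auto
  ultimately show ?thesis
    using assms by blast
qed

lemma Delta_few_chips:
  assumes "n < 2 + l"
  shows "G_stable l (Delta n)" and "reaches l (Delta n) D \<Longrightarrow> D = Delta n"
proof -
  have "chips_at (Delta n) v = (if v = 0 then {1..n} else {})" for v
    by (auto simp: chips_at_def Delta_def split: if_splits)
  then show stable: "G_stable l (Delta n)"
    using assms by (simp add: G_stable_def out_degree_line_graph)
  have "\<not> fires l (Delta n) D" for D
  proof
    assume "fires l (Delta n) D"
    then obtain v S where S: "S \<subseteq> chips_at (Delta n) v" "card S = out_degree (line_graph l) v"
      by (auto simp: fires_def)
    have "finite (chips_at (Delta n) v)"
      by (rule finite_subset[of _ "{1..n}"]) (auto simp: chips_at_def Delta_def split: if_splits)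
    then have "card S \<le> card (chips_at (Delta n) v)"
      using S(1) by (rule card_mono)
    then show False
      using stable S(2) by (auto simp: G_stable_def not_less [symmetric])
  qed
  then show "D = Delta n" if "reaches l (Delta n) D"
    using that unfolding reaches_def by (auto elim: converse_rtranclpE)
qed

theorem theorem3p3:
  fixes l n :: nat
  assumes "n \<ge> 1" and "[n = l] (mod 2)"
  shows "(\<exists>!D. labeled_configuration D \<and> G_stable l D \<and> reaches l (Delta n) D) \<and>
    (\<forall>D. labeled_configuration D \<and> G_stable l D \<and> reaches l (Delta n) D \<longrightarrow>
       (\<forall>i j. 1 \<le> i \<and> i \<le> j \<and> j \<le> n \<longrightarrow> the (D i) \<le> the (D j)))"
proof (cases "n < l")
  case True
  then have "G_stable l (Delta n)" "\<And>D. reaches l (Delta n) D \<Longrightarrow> D = Delta n"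
    using Delta_few_chips[of n l] by auto
  moreover have "labeled_configuration (Delta n)"
    by (auto simp: labeled_configuration_def Delta_def dom_def split: if_splits)
  moreover have "reaches l (Delta n) (Delta n)"
    by (simp add: reaches_def)
  moreover have "the (Delta n i) \<le> the (Delta n j)" if "1 \<le> i" "i \<le> j" "j \<le> n" for i j
    using that by (auto simp: Delta_def)
  ultimately show ?thesis
    by blast
next
  case False
  then have "even (n - l)"
    using assms(2) by (auto simp: cong_def even_iff_mod_2_eq_zero mod_eq_dvd_iff_nat)
  then obtain m where n: "n = 2 * m + l"
    using False by (metis evenE le_add_diff_inverse2 not_less)
  have "reaches l (Delta n) (Delta n)"
    by (simp add: reaches_def)
  then obtain D where D: "reaches l (Delta n) D" "G_stable l D"
    using ex_stable n by blast
  have labeled: "labeled_configuration D"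
    using reaches_Delta_dom[OF D(1)] by (auto simp: labeled_configuration_def)
  have eq: "E = sorted_configuration m l" if "reaches l (Delta n) E" "G_stable l E" for E
    using stable_eq_sorted that unfolding n by blast
  show ?thesis
  proof (intro conjI ex1I[of _ D] allI impI)
    fix E i j
    assume "labeled_configuration E \<and> G_stable l E \<and> reaches l (Delta n) E"
      and "1 \<le> i \<and> i \<le> j \<and> j \<le> n"
    then show "the (E i) \<le> the (E j)"
      using eq sorted_configuration_mono[of i j m l] n by blast
  qed (use D labeled eq in blast)+
qed

end
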